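(* The matrix bound of the classical Fisher information matrix due to a regular operator $\Pi_k$ is saturated at $\lambda$ (that is, $\mathcal F^k=\mathcal I^k$) if and only if $$\Pi_kL_{i\lambda}|\psi_{n\lambda}\rangle=\xi^k_i\,\Pi_k|\psi_{n\lambda}\rangle\qquad\text{for all } i,n,$$ where $\xi^k_i$ is real and independent of $n$.
   Context: A general quantum state depending on real parameters $\lambda=(\lambda_1,\lambda_2,\dots)$ is given by a density operator $\rho_\lambda=\sum_n p_{n\lambda}|\psi_{n\lambda}\rangle\langle\psi_{n\lambda}|$, where the $p_{n\lambda}$ are strictly positive and the $|\psi_{n\lambda}\rangle$ are orthonormal and do not vanish globally for all $\lambda$. Write $\partial_i=\partial/\partial\lambda_i$. $\Pi_k$ is an element of a POVM: a family of positive semidefinite operators, independent of $\lambda$, summing to the identity. $\Pi_k$ is called null (at $\lambda$) if $\operatorname{Tr}(\rho_\lambda\Pi_k)=0$, and regular otherwise. The symmetric logarithmic derivative (SLD) $L_{i\lambda}$ with respect to $\lambda_i$ is the Hermitian operator defined by $\tfrac12(L_{i\lambda}\rho_\lambda+\rho_\lambda L_{i\lambda})=\partial_i\rho_\lambda$. For a regular $\Pi_k$, its contribution to the classical Fisher information matrix is $\mathcal F^k_{ij}=\partial_i\operatorname{Tr}(\rho_\lambda\Pi_k)\,\partial_j\operatorname{Tr}(\rho_\lambda\Pi_k)/\operatorname{Tr}(\rho_\lambda\Pi_k)$, and its contribution to the quantum Fisher information matrix is $\mathcal I^k_{ij}=\operatorname{Re}[\operatorname{Tr}(\rho_\lambda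 L_{i\lambda}\Pi_kL_{j\lambda})]$. The matrix bound due to $\Pi_k$ is the inequality $\sum_{ij}u_i\mathcal F^k_{ij}u_j\le\sum_{ij}u_iu_j\mathcal I^k_{ij}$ for all real nonzero vectors $u$; it is saturated when equality holds for all such $u$. *)

theory Defs
  imports "HOL-Analysis.Analysis"
begin

text \<open>
  A complex Hilbert space of arbitrary (finite or infinite) dimension, presented as a real Hilbert
  space with a compatible complex structure. As in Dirac notation, the inner product is
  conjugate-linear in its first argument.
\<close>

class complex_hilbert = real_inner + banach +
  fixes scaleC :: "complex \<Rightarrow> 'a \<Rightarrow> 'a"  (infixr "*\<^sub>C" 75)
    and cinner :: "'a \<Rightarrow> 'a \<Rightarrow> complex"
  assumes scaleC_add_right: "a *\<^sub>C (x + y) = a *\<^sub>C x + a *\<^sub>C y"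
    and scaleC_add_left: "(a + b) *\<^sub>C x = a *\<^sub>C x + b *\<^sub>C x"
    and scaleC_scaleC: "a *\<^sub>C b *\<^sub>C x = (a * b) *\<^sub>C x"
    and scaleC_of_real: "complex_of_real r *\<^sub>C x = r *\<^sub>R x"
    and cinner_commute: "cinner x y = cnj (cinner y x)"
    and cinner_add_right: "cinner x (y + z) = cinner x y + cinner x z"
    and cinner_scaleC_right: "cinner x (a *\<^sub>C y) = a * cinner x y"
    and Re_cinner: "Re (cinner x y) = x \<bullet> y"

instantiation complex :: complex_hilbert
begin

definition scaleC_complex :: "complex \<Rightarrow> complex \<Rightarrow> complex"
  where "scaleC_complex a x = a * x"

definition cinner_complex :: "complex \<Rightarrow> complex \<Rightarrow> complex"
  where "cinner_complex x y = cnj x * y"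

instance
  by standard
    (auto simp: scaleC_complex_def cinner_complex_def algebra_simps scaleR_conv_of_real
      inner_complex_def)

end

instantiation vec :: (complex_hilbert, finite) complex_hilbert
begin

definition scaleC_vec :: "complex \<Rightarrow> 'a ^ 'b \<Rightarrow> 'a ^ 'b"
  where "scaleC_vec a x = (\<chi> i. a *\<^sub>C x $ i)"

definition cinner_vec :: "'a ^ 'b \<Rightarrow> 'a ^ 'b \<Rightarrow> complex"
  where "cinner_vec x y = (\<Sum>i\<in>UNIV. cinner (x $ i) (y $ i))"

instance
proof
  fix x y :: "'a ^ 'b"
  show "cinner x y = cnj (cinner y x)"
    unfolding cinner_vec_def cnj_sum by (intro sum.cong refl cinner_commute)
qed (simp_all add: scaleC_vec_def cinner_vec_def vec_eq_iff scaleC_add_right scaleC_add_left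
    scaleC_scaleC scaleC_of_real cinner_add_right cinner_scaleC_right Re_cinner inner_vec_def
    sum.distrib sum_distrib_left)

end

context complex_hilbert
begin

lemma cinner_add_left: "cinner (x + y) z = cinner x z + cinner y z"
  using cinner_add_right[of z x y] cinner_commute[of _ z] by simp

lemma cinner_scaleC_left: "cinner (a *\<^sub>C x) y = cnj a * cinner x y"
  using cinner_scaleC_right[of y a x] cinner_commute[of _ y] by simp

lemma norm_scaleC: "norm (a *\<^sub>C x) = cmod a * norm x"
proof -
  have "cinner (a *\<^sub>C x) (a *\<^sub>C x) = (a * cnj a) * cinner x x"
    by (simp add: cinner_scaleC_left cinner_scaleC_right mult.assoc)
  then have "cinner (a *\<^sub>C x) (a *\<^sub>C x) = complex_of_real ((cmod a)\<^sup>2) * cinner x x"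
    by (simp only: complex_norm_square)
  then have "Re (cinner (a *\<^sub>C x) (a *\<^sub>C x)) = (cmod a)\<^sup>2 * Re (cinner x x)"
    by simp
  then have "(norm (a *\<^sub>C x))\<^sup>2 = (cmod a * norm x)\<^sup>2"
    by (simp add: Re_cinner power2_norm_eq_inner power_mult_distrib)
  then show ?thesis by (simp add: power2_eq_iff_nonneg)
qed

lemma cmod_cinner_le: "cmod (cinner x y) \<le> norm x * norm y"
proof (cases "cinner x y = 0")
  case False
  define c where "c = cnj (sgn (cinner x y))"
  have c: "cmod c = 1" using False by (simp add: c_def norm_sgn)
  have "c * cinner x y = of_real (cmod (cinner x y))"
    using False by (simp add: c_def sgn_eq field_simps complex_norm_square[symmetric] power2_eq_square)
  then have "cmod (cinner x y) = Re (cinner x (c *\<^sub>C y))"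
    by (simp add: cinner_scaleC_right)
  also have "\<dots> = inner x (c *\<^sub>C y)" by (rule Re_cinner)
  also have "\<dots> \<le> norm x * norm (c *\<^sub>C y)" by (rule norm_cauchy_schwarz)
  also have "\<dots> = norm x * norm y" by (simp add: norm_scaleC c)
  finally show ?thesis .
qed simp

definition complete_orthonormal :: "'a set \<Rightarrow> bool"
  where "complete_orthonormal B \<longleftrightarrow>
    (\<forall>x\<in>B. \<forall>y\<in>B. cinner x y = (if x = y then 1 else 0)) \<and>
    (\<forall>x. (\<forall>e\<in>B. cinner e x = 0) \<longrightarrow> x = 0)"

end

lemma ex_complete_orthonormal: "\<exists>B :: 'a :: complex_hilbert set. complete_orthonormal B"
proof -
  define P where "P = {B :: 'a set. \<forall>x\<in>B. \<forall>y\<in>B. cinner x y = (if x = y then 1 else 0)}"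
  have "\<exists>M\<in>P. \<forall>X\<in>P. M \<subseteq> X \<longrightarrow> X = M"
  proof (rule subset_Zorn')
    fix C assume C: "subset.chain P C"
    have "cinner x y = (if x = y then 1 else 0)" if xy: "x \<in> \<Union>C" "y \<in> \<Union>C" for x y
    proof -
      obtain X Y where "X \<in> C" "Y \<in> C" "x \<in> X" "y \<in> Y" using xy by blast
      moreover from this have "X \<subseteq> Y \<or> Y \<subseteq> X" "X \<in> P" "Y \<in> P"
        using C by (auto simp: subset_chain_def)
      ultimately show ?thesis unfolding P_def by blast
    qed
    then show "\<Union>C \<in> P" unfolding P_def by blast
  qed
  then obtain B where B: "B \<in> P" and max: "\<And>X. X \<in> P \<Longrightarrow> B \<subseteq> X \<Longrightarrow> X = B" by blast
  have "x = 0" if x: "\<And>e. e \<in> B \<Longrightarrow> cinner e x = 0" for x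
  proof (rule ccontr)
    assume "x \<noteq> 0"
    define v where "v = complex_of_real (inverse (norm x)) *\<^sub>C x"
    have "Im (cinner x x) = 0"
      using arg_cong[OF cinner_commute[of x x], of Im] by simp
    then have "cinner x x = of_real ((norm x)\<^sup>2)"
      by (simp add: complex_eq_iff Re_cinner power2_norm_eq_inner)
    then have "cinner v v = of_real (inverse (norm x) * (inverse (norm x) * (norm x)\<^sup>2))"
      by (simp only: v_def cinner_scaleC_left cinner_scaleC_right complex_cnj_complex_of_real
          of_real_mult)
    moreover have "inverse r * (inverse r * r\<^sup>2) = 1" if "r \<noteq> 0" for r :: real
      using that by (simp add: power2_eq_square field_simps)
    ultimately have vv: "cinner v v = 1"
      using \<open>x \<noteq> 0\<close> by (metis norm_eq_zero of_real_1)
    have ev: "cinner e v = 0" "cinner v e = 0" if "e \<in> B" for e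
      using x[OF that] cinner_commute[of x e]
      by (simp_all add: v_def cinner_scaleC_left cinner_scaleC_right)
    have "insert v B \<in> P"
      using B vv ev unfolding P_def by auto
    then have "v \<in> B" using max by blast
    then show False using ev[of v] vv by simp
  qed
  moreover have "\<forall>x\<in>B. \<forall>y\<in>B. cinner x y = (if x = y then 1 else 0)"
    using B unfolding P_def by (rule CollectD)
  ultimately have "complete_orthonormal B"
    unfolding complete_orthonormal_def by metis
  then show ?thesis by (rule exI)
qed

text \<open>
  Operators are everywhere-defined bounded operators. The type \<open>'a \<Rightarrow>\<^sub>L 'a\<close> only records
  real-linearity, so complex-linearity is a separate predicate.
\<close>

definition clinear_op :: "('a :: complex_hilbert \<Rightarrow>\<^sub>L 'a) \<Rightarrow> bool"
  where "clinear_op A \<longleftrightarrow> (\<forall>c x. A (c *\<^sub>C x) = c *\<^sub>C A x)"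

definition hermitian_op :: "('a :: complex_hilbert \<Rightarrow>\<^sub>L 'a) \<Rightarrow> bool"
  where "hermitian_op A \<longleftrightarrow> clinear_op A \<and> (\<forall>x y. cinner (A x) y = cinner x (A y))"

definition psd_op :: "('a :: complex_hilbert \<Rightarrow>\<^sub>L 'a) \<Rightarrow> bool"
  where "psd_op A \<longleftrightarrow> hermitian_op A \<and> (\<forall>x. Re (cinner x (A x)) \<ge> 0)"

lift_definition ketbra :: "'a :: complex_hilbert \<Rightarrow> 'a \<Rightarrow> 'a \<Rightarrow>\<^sub>L 'a"
  is "\<lambda>x y z. cinner y z *\<^sub>C x"
proof (rule bounded_linear_intro)
  fix x y z w :: 'a and r :: real
  show "cinner y (z + w) *\<^sub>C x = cinner y z *\<^sub>C x + cinner y w *\<^sub>C x"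
    by (simp add: cinner_add_right scaleC_add_left)
  show "cinner y (r *\<^sub>R z) *\<^sub>C x = r *\<^sub>R (cinner y z *\<^sub>C x)"
    by (simp flip: scaleC_of_real add: cinner_scaleC_right scaleC_scaleC)
  show "norm (cinner y z *\<^sub>C x) \<le> norm z * (norm y * norm x)"
    using mult_right_mono[OF cmod_cinner_le[of y z] norm_ge_zero[of x]]
    by (simp add: norm_scaleC ac_simps)
qed

text \<open>
  The value of the sum is independent of the complete orthonormal set for trace-class \<open>A\<close>.
\<close>

definition op_trace :: "('a :: complex_hilbert \<Rightarrow>\<^sub>L 'a) \<Rightarrow> complex"
  where "op_trace A = (\<Sum>\<^sub>\<infinity>e\<in>(SOME B. complete_orthonormal B). cinner e (A e))"

text \<open>
  Trace-class operators are those of the form \<open>\<Sum>k. |x\<^sub>k\<rangle>\<langle>y\<^sub>k|\<close> with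
  \<open>\<Sum>k. \<parallel>x\<^sub>k\<parallel> \<parallel>y\<^sub>k\<parallel> < \<infinity>\<close>, and the trace norm is the infimum of the latter sum over
  all such representations (on a Hilbert space it equals the trace of \<open>|A|\<close>).
\<close>

definition nuclear_rep ::
    "('a :: complex_hilbert \<Rightarrow>\<^sub>L 'a) \<Rightarrow> (nat \<Rightarrow> 'a) \<Rightarrow> (nat \<Rightarrow> 'a) \<Rightarrow> bool"
  where "nuclear_rep A x y \<longleftrightarrow>
    summable (\<lambda>k. norm (x k) * norm (y k)) \<and> (\<lambda>k. ketbra (x k) (y k)) sums A"

definition trace_class :: "('a :: complex_hilbert \<Rightarrow>\<^sub>L 'a) \<Rightarrow> bool"
  where "trace_class A \<longleftrightarrow> (\<exists>x y. nuclear_rep A x y)"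

definition trace_norm :: "('a :: complex_hilbert \<Rightarrow>\<^sub>L 'a) \<Rightarrow> real"
  where "trace_norm A = Inf {\<Sum>k. norm (x k) * norm (y k) | x y. nuclear_rep A x y}"

text \<open>A value of trace \<open>1\<close> also forces the sum defining the trace to converge.\<close>

definition density_op :: "('a :: complex_hilbert \<Rightarrow>\<^sub>L 'a) \<Rightarrow> bool"
  where "density_op \<rho> \<longleftrightarrow> psd_op \<rho> \<and> op_trace \<rho> = 1"

text \<open>
  The sum over outcomes converges in the strong operator topology; for infinitely many outcomes
  convergence in norm would exclude even projective measurements in a basis.
\<close>

definition povm :: "'k set \<Rightarrow> ('k \<Rightarrow> 'a :: complex_hilbert \<Rightarrow>\<^sub>L 'a) \<Rightarrow> bool"
  where "povm K E \<longleftrightarrow>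
    (\<forall>k\<in>K. psd_op (E k)) \<and> (\<forall>x. ((\<lambda>k. E k x) has_sum x) K)"

definition partial_deriv :: "'p \<Rightarrow> (real ^ 'p \<Rightarrow> real) \<Rightarrow> real ^ 'p \<Rightarrow> real"
  where "partial_deriv i f l = deriv (\<lambda>t. f (l + t *\<^sub>R axis i 1)) 0"

text \<open>
  Partial derivatives of states are taken in trace norm, the topology in which states live;
  in finite dimension this is entrywise differentiation.
\<close>

definition has_partial_deriv_op ::
    "(real ^ 'p \<Rightarrow> 'a :: complex_hilbert \<Rightarrow>\<^sub>L 'a) \<Rightarrow> 'p \<Rightarrow> ('a \<Rightarrow>\<^sub>L 'a) \<Rightarrow> real ^ 'p \<Rightarrow> bool"
  where "has_partial_deriv_op \<rho> i D l \<longleftrightarrow>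
    (let R = (\<lambda>t. (1 / t) *\<^sub>R (\<rho> (l + t *\<^sub>R axis i 1) - \<rho> l) - D)
     in (\<forall>\<^sub>F t in at 0. trace_class (R t)) \<and> ((\<lambda>t. trace_norm (R t)) \<longlongrightarrow> 0) (at 0))"

definition is_SLD ::
    "(real ^ 'p \<Rightarrow> 'a :: complex_hilbert \<Rightarrow>\<^sub>L 'a) \<Rightarrow> 'p \<Rightarrow> real ^ 'p \<Rightarrow> ('a \<Rightarrow>\<^sub>L 'a) \<Rightarrow> bool"
  where "is_SLD \<rho> i l L \<longleftrightarrow>
    hermitian_op L \<and> has_partial_deriv_op \<rho> i ((1 / 2) *\<^sub>R ((L o\<^sub>L \<rho> l) + (\<rho> l o\<^sub>L L))) l"

text \<open>
  \<open>Tr (\<rho> E)\<close> is real for positive semidefinite \<open>E\<close>; taking \<open>Re\<close> only adjusts the type.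
\<close>

definition outcome_prob ::
    "(real ^ 'p \<Rightarrow> 'a :: complex_hilbert \<Rightarrow>\<^sub>L 'a) \<Rightarrow> ('a \<Rightarrow>\<^sub>L 'a) \<Rightarrow> real ^ 'p \<Rightarrow> real"
  where "outcome_prob \<rho> E l = Re (op_trace (\<rho> l o\<^sub>L E))"

definition regular_op :: "('a :: complex_hilbert \<Rightarrow>\<^sub>L 'a) \<Rightarrow> ('a \<Rightarrow>\<^sub>L 'a) \<Rightarrow> bool"
  where "regular_op r E \<longleftrightarrow> op_trace (r o\<^sub>L E) \<noteq> 0"

definition classical_fisher ::
    "(real ^ 'p \<Rightarrow> 'a :: complex_hilbert \<Rightarrow>\<^sub>L 'a) \<Rightarrow> ('a \<Rightarrow>\<^sub>L 'a) \<Rightarrow> real ^ 'p \<Rightarrow> real ^ 'p ^ 'p"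
  where "classical_fisher \<rho> E l =
    (\<chi> i j. partial_deriv i (outcome_prob \<rho> E) l * partial_deriv j (outcome_prob \<rho> E) l
            / outcome_prob \<rho> E l)"

definition quantum_fisher ::
    "('a :: complex_hilbert \<Rightarrow>\<^sub>L 'a) \<Rightarrow> ('p \<Rightarrow> 'a \<Rightarrow>\<^sub>L 'a) \<Rightarrow> ('a \<Rightarrow>\<^sub>L 'a) \<Rightarrow> real ^ 'p ^ 'p"
  where "quantum_fisher r L E = (\<chi> i j. Re (op_trace (r o\<^sub>L L i o\<^sub>L E o\<^sub>L L j)))"

definition matrix_bound_saturated :: "real ^ 'p ^ 'p \<Rightarrow> real ^ 'p ^ 'p \<Rightarrow> bool"
  where "matrix_bound_saturated F I \<longleftrightarrow>
    (\<forall>u :: real ^ 'p. u \<noteq> 0 \<longrightarrow>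
      (\<Sum>i\<in>UNIV. \<Sum>j\<in>UNIV. u $ i * F $ i $ j * u $ j) =
      (\<Sum>i\<in>UNIV. \<Sum>j\<in>UNIV. u $ i * u $ j * I $ i $ j))"

end

theory Submission
  imports Defs
begin

text \<open>
  Put \<open>\<langle>f, g\<rangle> = \<Sum>n. p\<^sub>n Re \<langle>f\<^sub>n|\<Pi> g\<^sub>n\<rangle>\<close> for families of vectors indexed by \<open>n\<close>; this is a positive
  semidefinite form. With \<open>T = (\<psi>\<^sub>n)\<^sub>n\<close> and \<open>S\<^sub>i = (L\<^sub>i \<psi>\<^sub>n)\<^sub>n\<close> one has \<open>Tr (\<rho> \<Pi>) = \<langle>T, T\<rangle>\<close>,
  \<open>\<partial>\<^sub>i Tr (\<rho> \<Pi>) = \<langle>S\<^sub>i, T\<rangle>\<close> and \<open>\<I>\<^sub>i\<^sub>j = \<langle>S\<^sub>i, S\<^sub>j\<rangle>\<close>, so the matrix bound is the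
  Cauchy-Schwarz inequality. Equality in its diagonal entries already says that \<open>S\<^sub>i - \<xi>\<^sub>i T\<close> has
  zero norm, where \<open>\<xi>\<^sub>i = \<langle>S\<^sub>i, T\<rangle> / \<langle>T, T\<rangle>\<close>; as all \<open>p\<^sub>n\<close> are positive and \<open>\<Pi>\<close> is positive
  semidefinite, this means that \<open>\<Pi>\<close> annihilates each of its components.

  In infinite dimension, traces of products of \<open>\<rho>\<close> with bounded operators are computed from the
  expansion \<open>\<rho> = \<Sum>n. p\<^sub>n |\<psi>\<^sub>n\<rangle>\<langle>\<psi>\<^sub>n|\<close> by Parseval and Fubini, and differentiation under the trace
  rests on \<open>|Tr (A \<Pi>)| \<le> \<parallel>A\<parallel>\<^sub>1 \<parallel>\<Pi>\<parallel>\<close>.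
\<close>

subsection \<open>Parseval's identity\<close>

text \<open>By Pythagoras the squared norm of a finite block is the sum of the squared norms of its
  terms, so the partial sums form a Cauchy net along the finite subsets of \<open>A\<close>. The
  index set may be uncountable, as a complete orthonormal set may be.\<close>

lemma summable_on_pairwise_orthogonal:
  fixes f :: "'i \<Rightarrow> 'a :: {real_inner, banach}"
  assumes orth: "pairwise (\<lambda>i j. orthogonal (f i) (f j)) A"
    and sq: "(\<lambda>i. (norm (f i))\<^sup>2) summable_on A"
  shows "f summable_on A"
proof -
  obtain S where S: "((\<lambda>i. (norm (f i))\<^sup>2) has_sum S) A"
    using sq by (auto simp: summable_on_def)
  have "\<exists>P. eventually P (finite_subsets_at_top A) \<and>
          (\<forall>F G. P F \<and> P G \<longrightarrow> dist (sum f F) (sum f G) < e)" if "e > 0" for e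
  proof -
    \<comment> \<open>Two partial sums within \<open>d\<close> of \<open>S\<close> differ by less
      than \<open>2 * d\<close>, which is the square of \<open>e / 2\<close>. The square root taken
      below then leaves \<open>e / 2\<close> for each of the two legs of the triangle inequality
      through \<open>sum f F1\<close>.\<close>
    define d where "d = (e / 2)\<^sup>2 / 2"
    have "d > 0" using that by (simp add: d_def)
    then have "\<forall>\<^sub>F F in finite_subsets_at_top A. dist (\<Sum>i\<in>F. (norm (f i))\<^sup>2) S < d"
      using S unfolding has_sum_def tendsto_iff by blast
    then obtain F1 where F1: "finite F1" "F1 \<subseteq> A"
      and F1_tail: "\<forall>F. finite F \<and> F1 \<subseteq> F \<and> F \<subseteq> A \<longrightarrow> dist (\<Sum>i\<in>F. (norm (f i))\<^sup>2) S < d"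
      unfolding eventually_finite_subsets_at_top by (elim exE conjE)
    have tail: "(\<Sum>i\<in>F. (norm (f i))\<^sup>2) - (\<Sum>i\<in>F1. (norm (f i))\<^sup>2) < (e / 2)\<^sup>2"
      if "finite F" "F1 \<subseteq> F" "F \<subseteq> A" for F
    proof -
      have "a - b < 2 * d" if "dist a S < d" "dist b S < d" for a b :: real
        using that unfolding dist_real_def by linarith
      then show ?thesis
        using F1_tail F1 \<open>finite F\<close> \<open>F1 \<subseteq> F\<close> \<open>F \<subseteq> A\<close> by (simp add: d_def)
    qed
    have near: "dist (sum f F) (sum f F1) < e / 2" if F: "finite F" "F1 \<subseteq> F" "F \<subseteq> A" for F
    proof -
      have "(norm (sum f (F - F1)))\<^sup>2 = (\<Sum>i\<in>F - F1. (norm (f i))\<^sup>2)"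
        using F orth by (intro norm_sum_Pythagorean) (auto intro: pairwise_subset[OF orth])
      also have "\<dots> < (e / 2)\<^sup>2"
        using tail[OF F] F by (simp add: sum_diff)
      finally have "norm (sum f (F - F1)) < e / 2"
        by (rule power_less_imp_less_base) (use \<open>e > 0\<close> in simp)
      then show ?thesis
        using F by (simp add: dist_norm sum_diff)
    qed
    have "dist (sum f F) (sum f G) < e"
      if "finite F \<and> F1 \<subseteq> F \<and> F \<subseteq> A" "finite G \<and> F1 \<subseteq> G \<and> G \<subseteq> A" for F G
      by (rule dist_triangle_half_l[of _ "sum f F1"]) (use that in \<open>blast intro: near\<close>)+
    moreover have "\<forall>\<^sub>F F in finite_subsets_at_top A. finite F \<and> F1 \<subseteq> F \<and> F \<subseteq> A"
      using F1 unfolding eventually_finite_subsets_at_top by (intro exI[of _ F1]) simp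
    ultimately show ?thesis
      by (intro exI[of _ "\<lambda>F. finite F \<and> F1 \<subseteq> F \<and> F \<subseteq> A"]) simp
  qed
  then have "cauchy_filter (filtermap (sum f) (finite_subsets_at_top A))"
    by (simp add: cauchy_filter_metric_filtermap)
  moreover have "complete (UNIV :: 'a set)"
    by (meson Cauchy_convergent UNIV_I complete_def convergent_def)
  ultimately obtain L where "(sum f \<longlongrightarrow> L) (finite_subsets_at_top A)"
    using complete_uniform[where S = UNIV] by (force simp add: filterlim_def)
  then show ?thesis
    unfolding summable_on_def has_sum_def by blast
qed

section \<open>The complex inner product as a bounded real-bilinear map\<close>

lemma cinner_scaleR_right: "cinner x (r *\<^sub>R y) = of_real r * cinner x y"
  by (simp flip: scaleC_of_real add: cinner_scaleC_right)

lemma cinner_scaleR_left: "cinner (r *\<^sub>R x) y = of_real r * cinner x y"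
  by (simp flip: scaleC_of_real add: cinner_scaleC_left)

lemma bounded_bilinear_cinner: "bounded_bilinear (cinner :: 'a :: complex_hilbert \<Rightarrow> _)"
proof
  show "\<exists>K. \<forall>x y :: 'a. norm (cinner x y) \<le> norm x * norm y * K"
    by (intro exI[of _ 1]) (simp add: cmod_cinner_le)
qed (simp_all add: cinner_add_left cinner_add_right cinner_scaleR_left cinner_scaleR_right
    scaleR_conv_of_real)

lemmas bounded_linear_cinner_right = bounded_bilinear.bounded_linear_right[OF bounded_bilinear_cinner]
lemmas cinner_diff_right = bounded_bilinear.diff_right[OF bounded_bilinear_cinner]
lemmas cinner_sum_right = bounded_bilinear.sum_right[OF bounded_bilinear_cinner]

lemma cmod_cinner_commute: "cmod (cinner x y) = cmod (cinner y x)"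
  by (metis cinner_commute complex_mod_cnj)

lemma cinner_self: "cinner x x = of_real ((norm x)\<^sup>2)"
proof -
  have "Im (cinner x x) = 0"
    using arg_cong[OF cinner_commute[of x x], of Im] by simp
  then show ?thesis
    by (simp add: complex_eq_iff Re_cinner power2_norm_eq_inner)
qed

lemma complete_orthonormalD:
  assumes "complete_orthonormal B"
  shows "e \<in> B \<Longrightarrow> f \<in> B \<Longrightarrow> cinner e f = (if e = f then 1 else 0)"
    and "(\<And>e. e \<in> B \<Longrightarrow> cinner e x = 0) \<Longrightarrow> x = 0"
  using assms unfolding complete_orthonormal_def by blast+

text \<open>The vector \<open>y\<close> is the orthogonal projection of \<open>x\<close> onto the
  span of \<open>F\<close>. Since \<open>x - y\<close> is orthogonal to \<open>y\<close>,
  Cauchy-Schwarz gives that \<open>y\<close> is no longer than \<open>x\<close>, and the left-hand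
  side is the squared norm of \<open>y\<close>.\<close>

lemma Bessel_inequality:
  assumes "complete_orthonormal B" "finite F" "F \<subseteq> B"
  shows "(\<Sum>e\<in>F. (cmod (cinner e x))\<^sup>2) \<le> (norm x)\<^sup>2"
proof -
  define y where "y = (\<Sum>e\<in>F. cinner e x *\<^sub>C e)"
  have ey: "cinner e y = cinner e x" if "e \<in> F" for e
  proof -
    have "cinner e y = (\<Sum>f\<in>F. cinner f x * (if e = f then 1 else 0))"
      unfolding y_def cinner_sum_right cinner_scaleC_right
    proof (rule sum.cong)
      fix f assume "f \<in> F"
      then have "cinner e f = (if e = f then 1 else 0)"
        using that assms complete_orthonormalD(1)[of B e f] by blast
      then show "cinner f x * cinner e f = cinner f x * (if e = f then 1 else 0)" by simp
    qed simp
    also have "\<dots> = cinner e x" using that \<open>finite F\<close> by (simp add: if_distrib cong: if_cong)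
    finally show ?thesis .
  qed
  \<comment> \<open>Kept for arbitrary \<open>z\<close>: the choice \<open>x - y\<close> yields
    orthogonality, the choice \<open>y\<close> yields the norm.\<close>
  have zy: "cinner z y = (\<Sum>e\<in>F. cinner e x * cinner z e)" for z
    by (simp add: y_def cinner_sum_right cinner_scaleC_right)
  have "cinner (x - y) y = (\<Sum>e\<in>F. cinner e x * cinner (x - y) e)"
    by (rule zy)
  also have "\<dots> = 0"
  proof (rule sum.neutral, rule ballI)
    fix e assume "e \<in> F"
    then have "cinner e (x - y) = 0" by (simp add: cinner_diff_right ey)
    then show "cinner e x * cinner (x - y) e = 0" using cinner_commute[of "x - y" e] by simp
  qed
  finally have "inner (x - y) y = 0" by (simp flip: Re_cinner)
  then have "inner x y = (norm y)\<^sup>2"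
    by (simp add: inner_diff_left power2_norm_eq_inner)
  then have "(norm y)\<^sup>2 \<le> norm x * norm y"
    using norm_cauchy_schwarz[of x y] by simp
  then have "norm y \<le> norm x"
    by (cases "norm y = 0") (auto simp: power2_eq_square)
  then have "(norm y)\<^sup>2 \<le> (norm x)\<^sup>2" by (simp add: power_mono)
  moreover have "cinner y y = (\<Sum>e\<in>F. of_real ((cmod (cinner e x))\<^sup>2))"
    unfolding zy
  proof (rule sum.cong)
    fix e assume "e \<in> F"
    then have "cinner y e = cnj (cinner e x)" using ey cinner_commute[of y e] by simp
    then show "cinner e x * cinner y e = of_real ((cmod (cinner e x))\<^sup>2)"
      by (simp only: complex_norm_square)
  qed simp
  then have "(norm y)\<^sup>2 = (\<Sum>e\<in>F. (cmod (cinner e x))\<^sup>2)"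
    unfolding cinner_self of_real_sum[symmetric] of_real_eq_iff .
  ultimately show ?thesis by simp
qed

text \<open>Bessel makes the coefficients square summable, so the orthogonal series converges to
  some \<open>z\<close>. Its coefficients agree with those of \<open>x\<close>, and completeness of
  \<open>B\<close> forces equality.\<close>

lemma Fourier_expansion:
  assumes B: "complete_orthonormal B"
  shows "((\<lambda>e. cinner e x *\<^sub>C e) has_sum x) B"
proof -
  have "(\<lambda>e. (cmod (cinner e x))\<^sup>2) summable_on B"
    by (rule nonneg_bdd_above_summable_on)
      (auto intro!: bdd_aboveI2[where M = "(norm x)\<^sup>2"] Bessel_inequality[OF B])
  moreover have nrm: "norm e = 1" if "e \<in> B" for e
    using complete_orthonormalD(1)[OF B that that] cinner_self[of e]
    by (metis abs_norm_cancel of_real_eq_1_iff power2_eq_1_iff abs_1 abs_minus_cancel)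
  ultimately have "(\<lambda>e. (norm (cinner e x *\<^sub>C e))\<^sup>2) summable_on B"
    by (simp add: norm_scaleC cong: summable_on_cong)
  moreover have "pairwise (\<lambda>e f. orthogonal (cinner e x *\<^sub>C e) (cinner f x *\<^sub>C f)) B"
    using complete_orthonormalD(1)[OF B]
    by (auto simp: pairwise_def orthogonal_def cinner_scaleC_left cinner_scaleC_right simp flip: Re_cinner)
  ultimately have "(\<lambda>e. cinner e x *\<^sub>C e) summable_on B"
    by (rule summable_on_pairwise_orthogonal[rotated])
  then obtain z where z: "((\<lambda>e. cinner e x *\<^sub>C e) has_sum z) B"
    unfolding summable_on_def by blast
  have "cinner f z = cinner f x" if "f \<in> B" for f
  proof -
    have "((\<lambda>e. cinner f (cinner e x *\<^sub>C e)) has_sum cinner f z) B"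
      by (rule has_sum_bounded_linear[OF bounded_linear_cinner_right z])
    moreover have "((\<lambda>e. cinner f (cinner e x *\<^sub>C e)) has_sum (\<Sum>e\<in>{f}. cinner f (cinner e x *\<^sub>C e))) B"
      by (rule has_sum_finite_neutralI[where B = "{f}"])
        (use that in \<open>auto simp: cinner_scaleC_right complete_orthonormalD(1)[OF B]\<close>)
    ultimately have "cinner f z = (\<Sum>e\<in>{f}. cinner f (cinner e x *\<^sub>C e))"
      by (rule has_sum_unique)
    then show ?thesis
      using that by (simp add: cinner_scaleC_right complete_orthonormalD(1)[OF B])
  qed
  then have "z - x = 0"
    by (intro complete_orthonormalD(2)[OF B]) (simp add: cinner_diff_right)
  then show ?thesis using z by simp
qed

lemma Parseval:
  assumes B: "complete_orthonormal B"
  shows "((\<lambda>e. cinner e x * cinner y e) has_sum cinner y x) B"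
  using has_sum_bounded_linear[OF bounded_linear_cinner_right Fourier_expansion[OF B, of x], of y]
  by (simp add: cinner_scaleC_right)

lemma Parseval_norm:
  assumes B: "complete_orthonormal B"
  shows "((\<lambda>e. (cmod (cinner e x))\<^sup>2) has_sum (norm x)\<^sup>2) B"
proof -
  have "cinner e x * cinner x e = of_real ((cmod (cinner e x))\<^sup>2)" for e
    using cinner_commute[of x e] by (simp only: complex_norm_square)
  then have "((\<lambda>e. complex_of_real ((cmod (cinner e x))\<^sup>2)) has_sum of_real ((norm x)\<^sup>2)) B"
    using Parseval[OF B, of x x] by (simp only: cinner_self)
  then show ?thesis
    using has_sum_Re by fastforce
qed

text \<open>Cauchy-Schwarz for finite sums, followed by Bessel in each factor. This is the
  domination that justifies exchanging sums in \<open>nuclear_sum_has_op_trace\<close>.\<close>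

lemma Parseval_abs_summable:
  assumes B: "complete_orthonormal B"
  shows "(\<lambda>e. norm (cinner e x * cinner y e)) summable_on B"
    and "(\<Sum>\<^sub>\<infinity>e\<in>B. norm (cinner e x * cinner y e)) \<le> norm x * norm y"
proof -
  have le: "(\<Sum>e\<in>F. norm (cinner e x * cinner y e)) \<le> norm x * norm y"
    if F: "finite F" "F \<subseteq> B" for F
  proof -
    have "(\<Sum>e\<in>F. norm (cinner e x * cinner y e)) =
        (\<Sum>e\<in>F. \<bar>cmod (cinner e x)\<bar> * \<bar>cmod (cinner e y)\<bar>)"
      by (simp add: norm_mult cmod_cinner_commute[of y])
    also have "\<dots> \<le> L2_set (\<lambda>e. cmod (cinner e x)) F * L2_set (\<lambda>e. cmod (cinner e y)) F"
      by (rule L2_set_mult_ineq)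
    also have "\<dots> \<le> norm x * norm y"
      using Bessel_inequality[OF B F]
      by (intro mult_mono) (auto simp: L2_set_def intro!: real_le_lsqrt sum_nonneg)
    finally show ?thesis .
  qed
  show sm: "(\<lambda>e. norm (cinner e x * cinner y e)) summable_on B"
    by (rule nonneg_bdd_above_summable_on) (auto intro!: bdd_aboveI2 le)
  show "(\<Sum>\<^sub>\<infinity>e\<in>B. norm (cinner e x * cinner y e)) \<le> norm x * norm y"
    by (rule infsum_le_finite_sums[OF sm le])
qed

subsection \<open>Traces of nuclear sums\<close>

text \<open>The infinite sum in \<open>op_trace\<close> takes the value 0 when it diverges, so
  \<open>op_trace\<close> alone is not visibly linear. This relation also records convergence, which
  makes the linearity rules below valid.\<close>

definition has_op_trace :: "('a :: complex_hilbert \<Rightarrow>\<^sub>L 'a) \<Rightarrow> complex \<Rightarrow> bool"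
  where "has_op_trace A t \<longleftrightarrow>
    ((\<lambda>e. cinner e (A e)) has_sum t) (SOME B. complete_orthonormal B)"

lemma op_trace_eqI: "has_op_trace A t \<Longrightarrow> op_trace A = t"
  unfolding has_op_trace_def op_trace_def by (rule infsumI)

lemma has_op_trace_add: "has_op_trace A s \<Longrightarrow> has_op_trace B t \<Longrightarrow> has_op_trace (A + B) (s + t)"
  unfolding has_op_trace_def by (simp add: blinfun.add_left cinner_add_right has_sum_add)

lemma has_op_trace_scaleR: "has_op_trace A s \<Longrightarrow> has_op_trace (r *\<^sub>R A) (r *\<^sub>R s)"
  unfolding has_op_trace_def
  by (simp add: blinfun.scaleR_left cinner_scaleR_right scaleR_conv_of_real has_sum_cmult_right)

lemma has_op_trace_diff:
  assumes "has_op_trace A s" "has_op_trace B t"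
  shows "has_op_trace (A - B) (s - t)"
  using has_op_trace_add[OF assms(1) has_op_trace_scaleR[OF assms(2), of "- 1"]] by simp

text \<open>A variant of \<open>nuclear_rep\<close> with an arbitrary index set and unconditional
  summation, so that the expansion of a state over \<open>N\<close> fits without enumerating
  \<open>N\<close>.\<close>

definition nuclear_sum ::
    "('a :: complex_hilbert \<Rightarrow>\<^sub>L 'a) \<Rightarrow> ('n \<Rightarrow> 'a) \<Rightarrow> ('n \<Rightarrow> 'a) \<Rightarrow> 'n set \<Rightarrow> bool"
  where "nuclear_sum A x y N \<longleftrightarrow>
    (\<lambda>n. norm (x n) * norm (y n)) summable_on N \<and>
    ((\<lambda>n. ketbra (x n) (y n)) has_sum A) N"

lemma ketbra_apply: "ketbra x y z = cinner y z *\<^sub>C x"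
  by (simp add: ketbra.rep_eq)

lemma norm_ketbra_le: "norm (ketbra x y) \<le> norm x * norm y"
proof (rule norm_blinfun_bound)
  fix z
  show "norm (ketbra x y z) \<le> norm x * norm y * norm z"
    using mult_right_mono[OF cmod_cinner_le[of y z] norm_ge_zero[of x]]
    by (simp add: ketbra_apply norm_scaleC ac_simps)
qed simp

lemma has_sum_ketbra_cinner:
  fixes A :: "'a :: complex_hilbert \<Rightarrow>\<^sub>L 'a"
  assumes "((\<lambda>n. ketbra (x n) (y n)) has_sum A) N"
  shows "((\<lambda>n. cinner e (x n) * cinner (y n) z) has_sum cinner e (A z)) N"
proof -
  have "bounded_linear (\<lambda>A :: 'a \<Rightarrow>\<^sub>L 'a. cinner e (A z))"
    by (intro bounded_linear_compose[OF bounded_linear_cinner_right]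
        bounded_bilinear.bounded_linear_left[OF bounded_bilinear_blinfun_apply])
  from has_sum_bounded_linear[OF this assms] show ?thesis
    by (simp add: ketbra_apply cinner_scaleC_right mult.commute)
qed

text \<open>Fubini for the double family over \<open>N\<close> and the basis \<open>B\<close>.
  Summing over \<open>B\<close> first gives \<open>cinner (y n) (x n)\<close> by Parseval; summing
  over \<open>N\<close> first gives the diagonal entries of \<open>A\<close>. Hence the trace
  converges and has a formula free of the basis.\<close>

lemma nuclear_sum_has_op_trace:
  fixes A :: "'a :: complex_hilbert \<Rightarrow>\<^sub>L 'a"
  assumes A: "nuclear_sum A x y N"
  shows "has_op_trace A (op_trace A)"
    and "((\<lambda>n. cinner (y n) (x n)) has_sum op_trace A) N"
proof -
  define B :: "'a set" where "B = (SOME B. complete_orthonormal B)"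
  have B: "complete_orthonormal B"
    unfolding B_def using ex_complete_orthonormal by (rule someI_ex)
  define f where "f = (\<lambda>(n, e). cinner e (x n) * cinner (y n) e)"
  have "(\<lambda>z. norm (f z)) summable_on N \<times> B"
    unfolding Infinite_Sum.abs_summable_on_Sigma_iff
  proof (intro conjI ballI)
    show "(\<lambda>e. norm (f (n, e))) summable_on B" for n
      using Parseval_abs_summable(1)[OF B] by (simp add: f_def)
    \<comment> \<open>Each inner sum is at most \<open>norm (x n) * norm (y n)\<close>, which is
      summable because \<open>A\<close> is a nuclear sum.\<close>
    show "(\<lambda>n. norm (\<Sum>\<^sub>\<infinity>e\<in>B. norm (f (n, e)))) summable_on N"
    proof (rule Infinite_Sum.abs_summable_on_comparison_test')
      show "(\<lambda>n. norm (x n) * norm (y n)) summable_on N"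
        using A unfolding nuclear_sum_def by blast
      show "norm (\<Sum>\<^sub>\<infinity>e\<in>B. norm (f (n, e))) \<le> norm (x n) * norm (y n)" for n
        using Parseval_abs_summable(2)[OF B, of "x n" "y n"]
        by (simp add: f_def abs_of_nonneg infsum_nonneg)
    qed
  qed
  then obtain S where S: "(f has_sum S) (N \<times> B)"
    using abs_summable_summable unfolding summable_on_def by blast
  have "((\<lambda>n. cinner (y n) (x n)) has_sum S) N"
    by (rule has_sum_SigmaD[OF S]) (use Parseval[OF B] in \<open>simp add: f_def\<close>)
  moreover have "((\<lambda>n. f (n, e)) has_sum cinner e (A e)) N" for e
    using A has_sum_ketbra_cinner[where e = e and z = e, of x y N A] by (simp add: f_def nuclear_sum_def)
  with S[unfolded has_sum_swap[of f]] have "((\<lambda>e. cinner e (A e)) has_sum S) B"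
    by (auto intro: has_sum_SigmaD)
  then have "has_op_trace A S"
    unfolding has_op_trace_def B_def .
  ultimately show "has_op_trace A (op_trace A)" "((\<lambda>n. cinner (y n) (x n)) has_sum op_trace A) N"
    by (simp_all add: op_trace_eqI)
qed

lemma nuclear_sum_op_trace_le:
  assumes "nuclear_sum A x y N"
  shows "cmod (op_trace A) \<le> (\<Sum>\<^sub>\<infinity>n\<in>N. norm (x n) * norm (y n))"
proof -
  have le: "cmod (cinner (y n) (x n)) \<le> norm (x n) * norm (y n)" for n
    using cmod_cinner_le[of "y n" "x n"] by (simp add: mult.commute)
  have sm: "(\<lambda>n. norm (x n) * norm (y n)) summable_on N"
    using assms unfolding nuclear_sum_def by blast
  have sm': "(\<lambda>n. cmod (cinner (y n) (x n))) summable_on N"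
    by (rule Infinite_Sum.abs_summable_on_comparison_test'[OF sm le])
  have "cmod (op_trace A) = cmod (\<Sum>\<^sub>\<infinity>n\<in>N. cinner (y n) (x n))"
    using infsumI[OF nuclear_sum_has_op_trace(2)[OF assms]] by simp
  also have "\<dots> \<le> (\<Sum>\<^sub>\<infinity>n\<in>N. cmod (cinner (y n) (x n)))"
    by (rule norm_infsum_bound[OF sm'])
  also have "\<dots> \<le> (\<Sum>\<^sub>\<infinity>n\<in>N. norm (x n) * norm (y n))"
    by (rule infsum_mono[OF sm' sm le])
  finally show ?thesis .
qed

text \<open>The factor \<open>S\<close> moves onto the left vectors. Complex linearity is what lets
  it pass the complex coefficient in \<open>ketbra\<close>.\<close>

lemma nuclear_sum_compose_left:
  assumes S: "clinear_op S" and A: "nuclear_sum A x y N"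
  shows "nuclear_sum (S o\<^sub>L A) (\<lambda>n. S (x n)) y N"
  unfolding nuclear_sum_def
proof
  have "(\<lambda>n. norm S * (norm (x n) * norm (y n))) summable_on N"
    using A unfolding nuclear_sum_def by (intro summable_on_cmult_right) simp
  then have "(\<lambda>n. norm (norm (S (x n)) * norm (y n))) summable_on N"
    by (rule Infinite_Sum.abs_summable_on_comparison_test')
      (simp add: norm_blinfun mult_right_mono flip: mult.assoc)
  then show "(\<lambda>n. norm (S (x n)) * norm (y n)) summable_on N" by simp
  have "S o\<^sub>L ketbra u v = ketbra (S u) v" for u v
    using S by (intro blinfun_eqI) (simp add: ketbra_apply clinear_op_def)
  moreover have "((\<lambda>n. S o\<^sub>L ketbra (x n) (y n)) has_sum (S o\<^sub>L A)) N"
    using A unfolding nuclear_sum_def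
    by (intro has_sum_bounded_linear[OF
          bounded_bilinear.bounded_linear_right[OF bounded_bilinear_blinfun_compose]]) blast
  ultimately show "((\<lambda>n. ketbra (S (x n)) (y n)) has_sum (S o\<^sub>L A)) N" by simp
qed

text \<open>A right factor acts on the right vectors through its adjoint, which is \<open>S\<close>
  itself here. The bound on the sums feeds the trace-norm estimate.\<close>

lemma nuclear_sum_compose_right:
  assumes S: "hermitian_op S" and A: "nuclear_sum A x y N"
  shows "nuclear_sum (A o\<^sub>L S) x (\<lambda>n. S (y n)) N"
    and "(\<Sum>\<^sub>\<infinity>n\<in>N. norm (x n) * norm (S (y n))) \<le> (\<Sum>\<^sub>\<infinity>n\<in>N. norm (x n) * norm (y n)) * norm S"
proof -
  have sm: "(\<lambda>n. norm (x n) * norm (y n) * norm S) summable_on N"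
    using A unfolding nuclear_sum_def by (intro summable_on_cmult_left) simp
  have le: "norm (x n) * norm (S (y n)) \<le> norm (x n) * norm (y n) * norm S" for n
    using mult_left_mono[OF norm_blinfun[of S "y n"] norm_ge_zero[of "x n"]] by (simp add: ac_simps)
  have "(\<lambda>n. norm (norm (x n) * norm (S (y n)))) summable_on N"
    using sm by (rule Infinite_Sum.abs_summable_on_comparison_test') (use le in simp)
  then have sm': "(\<lambda>n. norm (x n) * norm (S (y n))) summable_on N" by simp
  have "ketbra u v o\<^sub>L S = ketbra u (S v)" for u v
    using S by (intro blinfun_eqI) (simp add: ketbra_apply hermitian_op_def)
  moreover have "((\<lambda>n. ketbra (x n) (y n) o\<^sub>L S) has_sum (A o\<^sub>L S)) N"
    using A unfolding nuclear_sum_def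
    by (intro has_sum_bounded_linear[OF
          bounded_bilinear.bounded_linear_left[OF bounded_bilinear_blinfun_compose]]) blast
  ultimately show "nuclear_sum (A o\<^sub>L S) x (\<lambda>n. S (y n)) N"
    using sm' by (simp add: nuclear_sum_def)
  have "(\<Sum>\<^sub>\<infinity>n\<in>N. norm (x n) * norm (S (y n))) \<le> (\<Sum>\<^sub>\<infinity>n\<in>N. norm (x n) * norm (y n) * norm S)"
    by (rule infsum_mono[OF sm' sm le])
  also have "\<dots> = (\<Sum>\<^sub>\<infinity>n\<in>N. norm (x n) * norm (y n)) * norm S"
    using A unfolding nuclear_sum_def by (intro infsum_cmult_left) blast
  finally show "(\<Sum>\<^sub>\<infinity>n\<in>N. norm (x n) * norm (S (y n))) \<le> \<dots>" .
qed

section \<open>The trace norm dominates traces against bounded operators\<close>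

lemma nuclear_rep_imp_nuclear_sum:
  assumes "nuclear_rep A x y"
  shows "nuclear_sum A x y UNIV"
    and "(\<Sum>\<^sub>\<infinity>k. norm (x k) * norm (y k)) = (\<Sum>k. norm (x k) * norm (y k))"
proof -
  have sm: "summable (\<lambda>k. norm (x k) * norm (y k))" and A: "(\<lambda>k. ketbra (x k) (y k)) sums A"
    using assms unfolding nuclear_rep_def by blast+
  have hs: "((\<lambda>k. norm (x k) * norm (y k)) has_sum (\<Sum>k. norm (x k) * norm (y k))) UNIV"
    using sm by (intro norm_summable_imp_has_sum) (auto intro: summable_sums)
  \<comment> \<open>Absolute convergence turns the ordered series of \<open>nuclear_rep\<close> into
    an unconditional sum.\<close>
  have "summable (\<lambda>k. norm (ketbra (x k) (y k)))"
    by (rule summable_comparison_test'[OF sm]) (simp add: norm_ketbra_le)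
  then show "nuclear_sum A x y UNIV"
    using norm_summable_imp_has_sum[OF _ A] has_sum_imp_summable[OF hs]
    unfolding nuclear_sum_def by blast
  show "(\<Sum>\<^sub>\<infinity>k. norm (x k) * norm (y k)) = (\<Sum>k. norm (x k) * norm (y k))"
    by (rule infsumI[OF hs])
qed

text \<open>The bound holds for every nuclear representation of \<open>A\<close>, hence for the
  infimum over them, which is taken over a nonempty set because \<open>A\<close> is trace
  class.\<close>

lemma op_trace_compose_le_trace_norm:
  assumes A: "trace_class A" and S: "hermitian_op S"
  shows "cmod (op_trace (A o\<^sub>L S)) \<le> trace_norm A * norm S"
proof -
  have rep_le: "cmod (op_trace (A o\<^sub>L S)) \<le> (\<Sum>k. norm (x k) * norm (y k)) * norm S"
    if "nuclear_rep A x y" for x y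
  proof -
    note ns = nuclear_rep_imp_nuclear_sum[OF that]
    show ?thesis
      using nuclear_sum_op_trace_le[OF nuclear_sum_compose_right(1)[OF S ns(1)]]
        nuclear_sum_compose_right(2)[OF S ns(1)] ns(2) by simp
  qed
  obtain x0 y0 where xy0: "nuclear_rep A x0 y0"
    using A unfolding trace_class_def by blast
  show ?thesis
  \<comment> \<open>Passing to the infimum divides by \<open>norm S\<close>, so the zero case is
    treated apart.\<close>
  proof (cases "norm S = 0")
    case True
    then show ?thesis using rep_le[OF xy0] by simp
  next
    case False
    then have pos: "norm S > 0" by simp
    have "cmod (op_trace (A o\<^sub>L S)) / norm S \<le> trace_norm A"
      unfolding trace_norm_def
      by (rule cInf_greatest) (use xy0 rep_le pos in \<open>auto simp: pos_divide_le_eq\<close>)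
    then show ?thesis using pos by (simp add: pos_divide_le_eq)
  qed
qed

section \<open>Density operators as nuclear sums\<close>

lemma has_sum_finite_sum:
  fixes f :: "'i \<Rightarrow> 'b \<Rightarrow> 'c :: topological_comm_monoid_add"
  assumes "\<And>i. i \<in> F \<Longrightarrow> (f i has_sum s i) A"
  shows "((\<lambda>x. \<Sum>i\<in>F. f i x) has_sum (\<Sum>i\<in>F. s i)) A"
  using assms by (induction F rule: infinite_finite_induct) (simp_all add: has_sum_add)

text \<open>
  If the trace did not converge, the infinite sum defining it would be \<open>0\<close> rather than \<open>1\<close>, so
  every finite sum of weights is bounded by the trace.
\<close>

lemma density_op_weights_summable:
  fixes \<rho> :: "'a :: complex_hilbert \<Rightarrow>\<^sub>L 'a"
  assumes \<rho>: "density_op \<rho>"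
    and positive: "\<And>n. n \<in> N \<Longrightarrow> p n > 0"
    and unit: "\<And>n. n \<in> N \<Longrightarrow> norm (\<psi> n) = 1"
    and dec: "((\<lambda>n. p n *\<^sub>R ketbra (\<psi> n) (\<psi> n)) has_sum \<rho>) N"
  shows "p summable_on N"
proof (rule nonneg_bdd_above_summable_on)
  define B :: "'a set" where "B = (SOME B. complete_orthonormal B)"
  have B: "complete_orthonormal B"
    unfolding B_def using ex_complete_orthonormal by (rule someI_ex)
  have tr: "(\<Sum>\<^sub>\<infinity>e\<in>B. cinner e (\<rho> e)) = 1"
    using \<rho> unfolding density_op_def op_trace_def B_def by blast
  then have "(\<lambda>e. cinner e (\<rho> e)) summable_on B"
    using infsum_not_exists by fastforce
  then have "((\<lambda>e. cinner e (\<rho> e)) has_sum 1) B"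
    using tr has_sum_infsum by metis
  then have r: "((\<lambda>e. Re (cinner e (\<rho> e))) has_sum 1) B"
    using has_sum_Re by fastforce
  have diag: "((\<lambda>n. p n * (cmod (cinner e (\<psi> n)))\<^sup>2) has_sum Re (cinner e (\<rho> e))) N" for e
  proof -
    have "bounded_linear (\<lambda>A :: 'a \<Rightarrow>\<^sub>L 'a. Re (cinner e (A e)))"
      by (intro bounded_linear_compose[OF bounded_linear_Re]
          bounded_linear_compose[OF bounded_linear_cinner_right]
          bounded_bilinear.bounded_linear_left[OF bounded_bilinear_blinfun_apply])
    from has_sum_bounded_linear[OF this dec]
    have "((\<lambda>n. Re (of_real (p n) * (cinner (\<psi> n) e * cinner e (\<psi> n)))) has_sum Re (cinner e (\<rho> e))) N"
      by (simp add: ketbra_apply blinfun.scaleR_left cinner_scaleR_right cinner_scaleC_right)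
    moreover have "cinner (\<psi> n) e * cinner e (\<psi> n) = of_real ((cmod (cinner e (\<psi> n)))\<^sup>2)" for n
      using cinner_commute[of "\<psi> n" e] by (simp only: complex_norm_square mult.commute)
    ultimately show ?thesis
      by (simp only: of_real_mult[symmetric] Re_complex_of_real)
  qed
  show "bdd_above (sum p ` {F. F \<subseteq> N \<and> finite F})"
  proof (rule bdd_aboveI2)
    fix F assume F: "F \<in> {F. F \<subseteq> N \<and> finite F}"
    \<comment> \<open>Summed over the basis, the squared coefficients of each unit vector
      \<open>\<psi> n\<close> give 1, so the weights in \<open>F\<close> reappear. Termwise in
      \<open>e\<close>, the finite sum stays below the diagonal entry of
      \<open>\<rho>\<close>.\<close>
    have "((\<lambda>e. \<Sum>n\<in>F. p n * (cmod (cinner e (\<psi> n)))\<^sup>2) has_sum (\<Sum>n\<in>F. p n * (norm (\<psi> n))\<^sup>2)) B"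
      using F by (intro has_sum_finite_sum has_sum_cmult_right Parseval_norm[OF B])
    moreover have "(\<Sum>n\<in>F. p n * (norm (\<psi> n))\<^sup>2) = sum p F"
      using F unit by (intro sum.cong) auto
    ultimately have "((\<lambda>e. \<Sum>n\<in>F. p n * (cmod (cinner e (\<psi> n)))\<^sup>2) has_sum sum p F) B"
      by simp
    moreover have "(\<Sum>n\<in>F. p n * (cmod (cinner e (\<psi> n)))\<^sup>2) \<le> Re (cinner e (\<rho> e))" for e
      using F positive by (intro finite_sum_le_has_sum[OF diag]) (auto simp: less_imp_le)
    ultimately show "sum p F \<le> 1"
      by (intro has_sum_mono[OF _ r]) auto
  qed
qed (use positive less_imp_le in blast)

text \<open>The weight is absorbed into the left vector; the products of norms are then the weights
  themselves, already known to be summable.\<close>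

lemma density_op_nuclear_sum:
  fixes \<rho> :: "'a :: complex_hilbert \<Rightarrow>\<^sub>L 'a"
  assumes "density_op \<rho>"
    and "\<And>n. n \<in> N \<Longrightarrow> p n > 0"
    and unit: "\<And>n. n \<in> N \<Longrightarrow> norm (\<psi> n) = 1"
    and dec: "((\<lambda>n. p n *\<^sub>R ketbra (\<psi> n) (\<psi> n)) has_sum \<rho>) N"
  shows "nuclear_sum \<rho> (\<lambda>n. p n *\<^sub>R \<psi> n) \<psi> N"
  unfolding nuclear_sum_def
proof
  have "norm (p n *\<^sub>R \<psi> n) * norm (\<psi> n) = p n" if "n \<in> N" for n
    using assms(2)[OF that] unit[OF that] by simp
  then show "(\<lambda>n. norm (p n *\<^sub>R \<psi> n) * norm (\<psi> n)) summable_on N"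
    using density_op_weights_summable[OF assms] by (simp cong: summable_on_cong)
  have "r *\<^sub>R ketbra u v = ketbra (r *\<^sub>R u) v" for r and u v :: 'a
    by (intro blinfun_eqI)
      (simp add: ketbra_apply blinfun.scaleR_left scaleC_scaleC mult.commute flip: scaleC_of_real)
  then show "((\<lambda>n. ketbra (p n *\<^sub>R \<psi> n) (\<psi> n)) has_sum \<rho>) N"
    using dec by simp
qed

text \<open>The error of the difference quotient is the real part of the trace of \<open>R t\<close>
  composed with \<open>E\<close>, hence at most \<open>trace_norm (R t) * norm E\<close>, which
  tends to 0. The convergence assumptions allow this trace to be split linearly.\<close>

lemma partial_deriv_outcome_prob:
  fixes \<rho> :: "real ^ 'p \<Rightarrow> 'a :: complex_hilbert \<Rightarrow>\<^sub>L 'a"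
  assumes D: "has_partial_deriv_op \<rho> i D l"
    and E: "hermitian_op E"
    and near: "\<forall>\<^sub>F t in at 0. has_op_trace (\<rho> (l + t *\<^sub>R axis i 1) o\<^sub>L E)
      (op_trace (\<rho> (l + t *\<^sub>R axis i 1) o\<^sub>L E))"
    and at: "has_op_trace (\<rho> l o\<^sub>L E) (op_trace (\<rho> l o\<^sub>L E))"
    and tD: "has_op_trace (D o\<^sub>L E) d"
  shows "partial_deriv i (outcome_prob \<rho> E) l = Re d"
proof -
  define R where "R t = (1 / t) *\<^sub>R (\<rho> (l + t *\<^sub>R axis i 1) - \<rho> l) - D" for t
  define P where "P t = outcome_prob \<rho> E (l + t *\<^sub>R axis i 1)" for t
  have tc: "\<forall>\<^sub>F t in at 0. trace_class (R t)" and lim: "((\<lambda>t. trace_norm (R t)) \<longlongrightarrow> 0) (at 0)"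
    using D unfolding has_partial_deriv_op_def Let_def R_def by auto
  have "\<forall>\<^sub>F t in at 0. norm ((P t - P 0) / t - Re d) \<le> trace_norm (R t) * norm E"
    using tc near
  proof eventually_elim
    case (elim t)
    interpret c: bounded_bilinear "(o\<^sub>L) :: ('a \<Rightarrow>\<^sub>L 'a) \<Rightarrow> _" by (rule bounded_bilinear_blinfun_compose)
    have "op_trace (R t o\<^sub>L E) = (1 / t) *\<^sub>R (op_trace (\<rho> (l + t *\<^sub>R axis i 1) o\<^sub>L E) - op_trace (\<rho> l o\<^sub>L E)) - d"
      unfolding R_def c.diff_left c.scaleR_left
      by (intro op_trace_eqI has_op_trace_diff has_op_trace_scaleR elim at tD)
    then have "(P t - P 0) / t - Re d = Re (op_trace (R t o\<^sub>L E))"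
      by (simp add: P_def outcome_prob_def)
    also have "norm \<dots> \<le> cmod (op_trace (R t o\<^sub>L E))"
      by (simp add: abs_Re_le_cmod)
    also have "\<dots> \<le> trace_norm (R t) * norm E"
      by (rule op_trace_compose_le_trace_norm[OF elim(1) E])
    finally show ?case by simp
  qed
  then have "((\<lambda>t. (P t - P 0) / t - Re d) \<longlongrightarrow> 0) (at 0)"
    by (rule Lim_null_comparison) (use tendsto_mult_left_zero[OF lim] in simp)
  then have "((\<lambda>t. (P t - P 0) / t) \<longlongrightarrow> Re d) (at 0)"
    by (simp add: LIM_zero_iff)
  then have "(P has_real_derivative Re d) (at 0)"
    by (simp add: DERIV_def)
  then show ?thesis
    unfolding partial_deriv_def P_def by (rule DERIV_imp_deriv)
qed

text \<open>The form is nonnegative at \<open>x + t *\<^sub>R y\<close> with \<open>y = E x\<close>.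
  As its value at \<open>x\<close> is zero, the term linear in \<open>t\<close> would make it
  negative for a suitable \<open>t\<close> unless \<open>y\<close> vanishes.\<close>

lemma psd_op_eq_0:
  assumes E: "psd_op E" and x: "inner x (E x) = 0"
  shows "E x = 0"
proof -
  define y where "y = E x"
  have sa: "inner (E u) v = inner u (E v)" for u v
    using E unfolding psd_op_def hermitian_op_def by (metis Re_cinner)
  have nn: "inner u (E u) \<ge> 0" for u
    using E unfolding psd_op_def by (simp flip: Re_cinner)
  define c where "c = inner y (E y)"
  define a where "a = inner y y"
  \<comment> \<open>The quadratic \<open>2 * t * a + t\<^sup>2 * c\<close> is least at
    \<open>- a / c\<close>; adding 1 to the denominator avoids division by zero and keeps the value
    negative whenever \<open>a\<close> is nonzero.\<close>
  define t where "t = - a / (c + 1)"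
  have "c \<ge> 0" using nn by (simp add: c_def)
  have "0 \<le> inner (x + t *\<^sub>R y) (E (x + t *\<^sub>R y))" by (rule nn)
  also have "\<dots> = 2 * t * a + t\<^sup>2 * c"
    using sa[of x y] x
    by (simp add: blinfun.add_right blinfun.scaleR_right inner_add_left inner_add_right y_def[symmetric]
        a_def c_def inner_commute power2_eq_square algebra_simps)
  also have "\<dots> = - (a\<^sup>2 * (c + 2)) / (c + 1)\<^sup>2"
    using \<open>c \<ge> 0\<close> by (simp add: t_def power2_eq_square divide_simps) (simp add: algebra_simps)
  finally have "a\<^sup>2 * (c + 2) \<le> 0"
    using \<open>c \<ge> 0\<close> by (auto simp: divide_le_0_iff)
  then have "a = 0"
    using \<open>c \<ge> 0\<close> by (simp add: mult_le_0_iff)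
  then show ?thesis by (simp add: a_def y_def)
qed

subsection \<open>Saturation of the matrix bound\<close>

lemma hermitian_op_inner: "hermitian_op A \<Longrightarrow> inner (A x) y = inner x (A y)"
  unfolding hermitian_op_def by (metis Re_cinner)

lemma hermitian_op_cinner_self: "hermitian_op A \<Longrightarrow> cinner x (A x) = of_real (inner x (A x))"
  using cinner_commute[of x "A x"]
  by (simp add: hermitian_op_def complex_eq_iff Re_cinner)

section \<open>Traces evaluated on the expansion of the state\<close>

context
  fixes r E :: "'a :: complex_hilbert \<Rightarrow>\<^sub>L 'a" and N :: "'n set" and p :: "'n \<Rightarrow> real"
    and \<psi> :: "'n \<Rightarrow> 'a"
  assumes r: "nuclear_sum r (\<lambda>n. p n *\<^sub>R \<psi> n) \<psi> N"
    and E: "hermitian_op E"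
begin

text \<open>Hermiticity of \<open>E\<close> makes every term of the trace real. The second claim
  transfers regularity, stated for the complex trace, to the real outcome probability.\<close>

lemma has_sum_op_trace_effect:
  "((\<lambda>n. p n * inner (\<psi> n) (E (\<psi> n))) has_sum Re (op_trace (r o\<^sub>L E))) N"
  "op_trace (r o\<^sub>L E) = of_real (Re (op_trace (r o\<^sub>L E)))"
proof -
  have "cinner (E (\<psi> n)) (p n *\<^sub>R \<psi> n) = of_real (p n * inner (\<psi> n) (E (\<psi> n)))" for n
    using E hermitian_op_cinner_self[OF E, of "\<psi> n"]
    by (simp add: cinner_scaleR_right hermitian_op_def)
  then have *: "((\<lambda>n. complex_of_real (p n * inner (\<psi> n) (E (\<psi> n)))) has_sum op_trace (r o\<^sub>L E)) N"
    using nuclear_sum_has_op_trace(2)[OF nuclear_sum_compose_right(1)[OF E r]] by simp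
  then show **: "((\<lambda>n. p n * inner (\<psi> n) (E (\<psi> n))) has_sum Re (op_trace (r o\<^sub>L E))) N"
    using has_sum_Re by fastforce
  show "op_trace (r o\<^sub>L E) = of_real (Re (op_trace (r o\<^sub>L E)))"
    by (rule has_sum_unique[OF * has_sum_of_real[OF **]])
qed

text \<open>The two halves of the symmetrized product contribute complex conjugate terms, so their
  average has the stated real part. The value \<open>d\<close> comes with convergence of the trace,
  as \<open>partial_deriv_outcome_prob\<close> requires.\<close>

lemma has_sum_op_trace_SLD:
  assumes L: "hermitian_op L"
  shows "\<exists>d. has_op_trace (((1 / 2) *\<^sub>R ((L o\<^sub>L r) + (r o\<^sub>L L))) o\<^sub>L E) d \<and>
    ((\<lambda>n. p n * inner (L (\<psi> n)) (E (\<psi> n))) has_sum Re d) N"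
proof -
  have cL: "clinear_op L" using L by (simp add: hermitian_op_def)
  note s1 = nuclear_sum_compose_right(1)[OF E nuclear_sum_compose_left[OF cL r]]
    and s2 = nuclear_sum_compose_right(1)[OF E nuclear_sum_compose_right(1)[OF L r]]
  define d where "d = (1 / 2) *\<^sub>R (op_trace (L o\<^sub>L r o\<^sub>L E) + op_trace (r o\<^sub>L L o\<^sub>L E))"
  interpret c: bounded_bilinear "(o\<^sub>L) :: ('a \<Rightarrow>\<^sub>L 'a) \<Rightarrow> _" by (rule bounded_bilinear_blinfun_compose)
  have "has_op_trace (((1 / 2) *\<^sub>R ((L o\<^sub>L r) + (r o\<^sub>L L))) o\<^sub>L E) d"
    unfolding d_def c.scaleR_left c.add_left
    by (intro has_op_trace_scaleR has_op_trace_add nuclear_sum_has_op_trace(1)[OF s1]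
        nuclear_sum_has_op_trace(1)[OF s2])
  moreover have "((\<lambda>n. p n * inner (L (\<psi> n)) (E (\<psi> n))) has_sum Re d) N"
  proof -
    have "((\<lambda>n. Re ((1 / 2) *\<^sub>R (cinner (E (\<psi> n)) (L (p n *\<^sub>R \<psi> n)) + cinner (E (L (\<psi> n))) (p n *\<^sub>R \<psi> n)))) has_sum Re d) N"
      unfolding d_def
      by (intro has_sum_Re has_sum_scaleR has_sum_add nuclear_sum_has_op_trace(2)[OF s1]
          nuclear_sum_has_op_trace(2)[OF s2])
    moreover have "Re ((1 / 2) *\<^sub>R (cinner (E (\<psi> n)) (L (p n *\<^sub>R \<psi> n)) + cinner (E (L (\<psi> n))) (p n *\<^sub>R \<psi> n)))
        = p n * inner (L (\<psi> n)) (E (\<psi> n))" for n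
      by (simp add: Re_cinner hermitian_op_inner[OF E] blinfun.scaleR_right)
        (simp add: inner_commute hermitian_op_inner[OF E, symmetric])
    ultimately show ?thesis by simp
  qed
  ultimately show ?thesis by blast
qed

text \<open>The three right factors are moved in turn onto the right vector, which becomes
  \<open>L j (E (L i (\<psi> n)))\<close>; hermiticity then redistributes them.\<close>

lemma has_sum_quantum_fisher:
  assumes "\<And>i. hermitian_op (L i)"
  shows "((\<lambda>n. p n * inner (L i (\<psi> n)) (E (L j (\<psi> n)))) has_sum quantum_fisher r L E $ i $ j) N"
proof -
  note s = nuclear_sum_compose_right(1)[OF assms[of j] nuclear_sum_compose_right(1)[OF E
        nuclear_sum_compose_right(1)[OF assms[of i] r]]]
  have "Re (cinner (L j (E (L i (\<psi> n)))) (p n *\<^sub>R \<psi> n)) = p n * inner (L i (\<psi> n)) (E (L j (\<psi> n)))" for n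
    by (simp add: Re_cinner hermitian_op_inner[OF E] hermitian_op_inner[OF assms])
  then show ?thesis
    using has_sum_Re[OF nuclear_sum_has_op_trace(2)[OF s]] by (simp add: quantum_fisher_def)
qed

end

text \<open>Testing with a coordinate vector isolates a diagonal entry. Equality of the other
  entries is recovered later through the proportionality condition.\<close>

lemma matrix_bound_saturated_diagonal:
  fixes F I :: "real ^ 'p ^ 'p"
  assumes "matrix_bound_saturated F I"
  shows "F $ i $ i = I $ i $ i"
proof -
  have "axis i (1 :: real) \<noteq> 0" by (simp add: axis_eq_0_iff)
  with assms have "(\<Sum>j\<in>UNIV. \<Sum>k\<in>UNIV. axis i 1 $ j * F $ j $ k * axis i 1 $ k) =
      (\<Sum>j\<in>UNIV. \<Sum>k\<in>UNIV. axis i 1 $ j * axis i 1 $ k * I $ j $ k)"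
    unfolding matrix_bound_saturated_def by blast
  then show ?thesis
    by (simp add: axis_def if_distrib[of "\<lambda>x. x * _"] if_distrib[of "\<lambda>x. _ * x"] cong: if_cong)
qed

lemma matrix_bound_saturated_refl: "matrix_bound_saturated F F"
  unfolding matrix_bound_saturated_def by (simp add: mult_ac)

theorem theorem1:
  fixes \<Theta> :: "(real ^ 'p) set"
    and l :: "real ^ 'p"
    and \<rho> :: "real ^ 'p \<Rightarrow> 'a :: complex_hilbert \<Rightarrow>\<^sub>L 'a"
    and N :: "'n set"
    and p :: "'n \<Rightarrow> real ^ 'p \<Rightarrow> real"
    and \<psi> :: "'n \<Rightarrow> real ^ 'p \<Rightarrow> 'a"
    and L :: "'p \<Rightarrow> 'a \<Rightarrow>\<^sub>L 'a"
    and K :: "'k set"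
    and E :: "'k \<Rightarrow> 'a \<Rightarrow>\<^sub>L 'a"
    and k :: 'k
  assumes "open \<Theta>" and "l \<in> \<Theta>"
    and density: "\<And>l'. l' \<in> \<Theta> \<Longrightarrow> density_op (\<rho> l')"
    and positive: "\<And>l' n. l' \<in> \<Theta> \<Longrightarrow> n \<in> N \<Longrightarrow> p n l' > 0"
    and orthonormal: "\<And>l' m n. l' \<in> \<Theta> \<Longrightarrow> m \<in> N \<Longrightarrow> n \<in> N \<Longrightarrow>
      cinner (\<psi> m l') (\<psi> n l') = (if m = n then 1 else 0)"
    and decomposition: "\<And>l'. l' \<in> \<Theta> \<Longrightarrow>
      ((\<lambda>n. p n l' *\<^sub>R ketbra (\<psi> n l') (\<psi> n l')) has_sum \<rho> l') N"
    and SLD: "\<And>i. is_SLD \<rho> i l (L i)"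
    and povm: "povm K E" and "k \<in> K"
    and regular: "regular_op (\<rho> l) (E k)"
  shows
    "(matrix_bound_saturated (classical_fisher \<rho> (E k) l) (quantum_fisher (\<rho> l) L (E k))
        \<longleftrightarrow> classical_fisher \<rho> (E k) l = quantum_fisher (\<rho> l) L (E k)) \<and>
     (matrix_bound_saturated (classical_fisher \<rho> (E k) l) (quantum_fisher (\<rho> l) L (E k))
        \<longleftrightarrow> (\<exists>\<xi> :: 'p \<Rightarrow> real. \<forall>i. \<forall>n\<in>N. E k (L i (\<psi> n l)) = \<xi> i *\<^sub>R E k (\<psi> n l)))"
proof -
  have psd: "psd_op (E k)"
    using povm \<open>k \<in> K\<close> unfolding povm_def by blast
  then have herm: "hermitian_op (E k)" unfolding psd_op_def by blast
  have hermL: "hermitian_op (L i)" for i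
    using SLD[of i] unfolding is_SLD_def by blast
  have nuc: "nuclear_sum (\<rho> l') (\<lambda>n. p n l' *\<^sub>R \<psi> n l') (\<lambda>n. \<psi> n l') N" if "l' \<in> \<Theta>" for l'
  proof (rule density_op_nuclear_sum[OF density[OF that] positive[OF that] _ decomposition[OF that]])
    fix n assume "n \<in> N"
    then have "Re (cinner (\<psi> n l') (\<psi> n l')) = 1" using orthonormal[OF that] by simp
    then show "norm (\<psi> n l') = 1" by (simp add: Re_cinner norm_eq_sqrt_inner)
  qed
  have trace: "has_op_trace (\<rho> l' o\<^sub>L E k) (op_trace (\<rho> l' o\<^sub>L E k))" if "l' \<in> \<Theta>" for l'
    by (rule nuclear_sum_has_op_trace(1)[OF nuclear_sum_compose_right(1)[OF herm nuc[OF that]]])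
  define P where "P = outcome_prob \<rho> (E k) l"
  define d where "d i = partial_deriv i (outcome_prob \<rho> (E k)) l" for i
  define F where "F = classical_fisher \<rho> (E k) l"
  define I where "I = quantum_fisher (\<rho> l) L (E k)"
  have F: "F $ i $ j = d i * d j / P" for i j
    by (simp add: F_def classical_fisher_def d_def P_def)
  note nucl = nuc[OF \<open>l \<in> \<Theta>\<close>]
  have P: "((\<lambda>n. p n l * inner (\<psi> n l) (E k (\<psi> n l))) has_sum P) N"
    unfolding P_def outcome_prob_def by (rule has_sum_op_trace_effect(1)[OF nucl herm])
  have "P \<noteq> 0"
    using regular has_sum_op_trace_effect(2)[OF nucl herm]
    unfolding regular_op_def P_def outcome_prob_def by auto
  have I: "((\<lambda>n. p n l * inner (L i (\<psi> n l)) (E k (L j (\<psi> n l)))) has_sum I $ i $ j) N" for i j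
    unfolding I_def by (rule has_sum_quantum_fisher[OF nucl herm hermL])
  have d: "((\<lambda>n. p n l * inner (L i (\<psi> n l)) (E k (\<psi> n l))) has_sum d i) N" for i
  proof -
    have "((\<lambda>t. l + t *\<^sub>R axis i 1) \<longlongrightarrow> l + 0 *\<^sub>R axis i 1) (at 0)"
      by (intro tendsto_intros)
    \<comment> \<open>Openness of \<open>\<Theta>\<close> makes the expansion, and so the
      convergence of the trace, available at the displaced parameters near \<open>l\<close>.\<close>
    then have "\<forall>\<^sub>F t in at 0. l + t *\<^sub>R axis i 1 \<in> \<Theta>"
      using \<open>open \<Theta>\<close> \<open>l \<in> \<Theta>\<close> by (simp add: topological_tendstoD)
    then have near: "\<forall>\<^sub>F t in at 0. has_op_trace (\<rho> (l + t *\<^sub>R axis i 1) o\<^sub>L E k)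
        (op_trace (\<rho> (l + t *\<^sub>R axis i 1) o\<^sub>L E k))"
      by (rule eventually_mono) (rule trace)
    obtain c where c: "has_op_trace (((1 / 2) *\<^sub>R ((L i o\<^sub>L \<rho> l) + (\<rho> l o\<^sub>L L i))) o\<^sub>L E k) c"
      "((\<lambda>n. p n l * inner (L i (\<psi> n l)) (E k (\<psi> n l))) has_sum Re c) N"
      using has_sum_op_trace_SLD[OF nucl herm hermL] by blast
    have "d i = Re c"
      unfolding d_def
      by (rule partial_deriv_outcome_prob[OF _ herm near trace[OF \<open>l \<in> \<Theta>\<close>] c(1)])
        (use SLD[of i] in \<open>simp add: is_SLD_def\<close>)
    with c(2) show ?thesis by simp
  qed
  have nonneg: "inner x (E k x) \<ge> 0" for x
    using psd unfolding psd_op_def by (simp flip: Re_cinner)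

  have proportional: "\<exists>\<xi> :: 'p \<Rightarrow> real. \<forall>i. \<forall>n\<in>N. E k (L i (\<psi> n l)) = \<xi> i *\<^sub>R E k (\<psi> n l)"
    if diag: "\<And>i. F $ i $ i = I $ i $ i"
  \<comment> \<open>Both \<open>d i\<close> and \<open>P\<close> are sums over all of
    \<open>N\<close>, so this coefficient depends on \<open>i\<close> alone, as the claim
    demands.\<close>
  proof (intro exI[of _ "\<lambda>i. d i / P"] allI ballI)
    fix i n assume n: "n \<in> N"
    define \<xi> where "\<xi> = d i / P"
    define v where "v n = L i (\<psi> n l) - \<xi> *\<^sub>R \<psi> n l" for n
    have "p n l * inner (v n) (E k (v n)) = p n l * inner (L i (\<psi> n l)) (E k (L i (\<psi> n l)))
        + (- (2 * \<xi>)) * (p n l * inner (L i (\<psi> n l)) (E k (\<psi> n l)))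
        + \<xi>\<^sup>2 * (p n l * inner (\<psi> n l) (E k (\<psi> n l)))" for n
      using hermitian_op_inner[OF herm, of "\<psi> n l" "L i (\<psi> n l)"]
      by (simp add: v_def blinfun.diff_right blinfun.scaleR_right inner_diff_left inner_diff_right
          inner_commute power2_eq_square algebra_simps)
    moreover have "((\<lambda>n. p n l * inner (L i (\<psi> n l)) (E k (L i (\<psi> n l)))
        + (- (2 * \<xi>)) * (p n l * inner (L i (\<psi> n l)) (E k (\<psi> n l)))
        + \<xi>\<^sup>2 * (p n l * inner (\<psi> n l) (E k (\<psi> n l)))) has_sum
        (I $ i $ i + (- (2 * \<xi>)) * d i + \<xi>\<^sup>2 * P)) N"
      by (intro has_sum_add has_sum_cmult_right I d P)
    \<comment> \<open>The diagonal hypothesis says that \<open>I $ i $ i\<close> is the square of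
      \<open>d i\<close> divided by \<open>P\<close>, so completing the square leaves
      nothing.\<close>
    moreover have "I $ i $ i + (- (2 * \<xi>)) * d i + \<xi>\<^sup>2 * P = 0"
      using \<open>P \<noteq> 0\<close> diag[of i] by (simp add: F \<xi>_def power2_eq_square field_simps)
    ultimately have "((\<lambda>n. p n l * inner (v n) (E k (v n))) has_sum 0) N" by simp
    \<comment> \<open>A sum of nonnegative terms with value 0 has only zero terms; the strictly
      positive weight can then be cancelled.\<close>
    then have "p n l * inner (v n) (E k (v n)) = 0"
      by (rule nonneg_has_sum_le_0D)
        (use n nonneg positive[OF \<open>l \<in> \<Theta>\<close>] in \<open>simp_all add: mult_nonneg_nonneg less_imp_le\<close>)
    then have "E k (v n) = 0"
      using positive[OF \<open>l \<in> \<Theta>\<close> n] by (intro psd_op_eq_0[OF psd]) simp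
    then show "E k (L i (\<psi> n l)) = (d i / P) *\<^sub>R E k (\<psi> n l)"
      by (simp add: v_def \<xi>_def blinfun.diff_right blinfun.scaleR_right)
  qed

  have equal: "F = I"
    if \<xi>: "\<forall>i. \<forall>n\<in>N. E k (L i (\<psi> n l)) = \<xi> i *\<^sub>R E k (\<psi> n l)" for \<xi> :: "'p \<Rightarrow> real"
  proof -
    have dP: "d i = \<xi> i * P" for i
    proof (rule has_sum_unique[OF d])
      have "p n l * inner (L i (\<psi> n l)) (E k (\<psi> n l)) = \<xi> i * (p n l * inner (\<psi> n l) (E k (\<psi> n l)))"
        if "n \<in> N" for n
      proof -
        \<comment> \<open>Proportionality concerns \<open>E k\<close> applied to
          \<open>L i (\<psi> n l)\<close>, so \<open>E k\<close> is first moved onto that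
          vector.\<close>
        have "inner (L i (\<psi> n l)) (E k (\<psi> n l)) = inner (\<psi> n l) (E k (L i (\<psi> n l)))"
          by (metis hermitian_op_inner[OF herm] inner_commute)
        with \<xi> that show ?thesis by simp
      qed
      from iffD2[OF has_sum_cong[OF this] has_sum_cmult_right[OF P]]
      show "((\<lambda>n. p n l * inner (L i (\<psi> n l)) (E k (\<psi> n l))) has_sum \<xi> i * P) N" .
    qed
    have "I $ i $ j = \<xi> j * d i" for i j
    proof (rule has_sum_unique[OF I])
      have "p n l * inner (L i (\<psi> n l)) (E k (L j (\<psi> n l))) =
          \<xi> j * (p n l * inner (L i (\<psi> n l)) (E k (\<psi> n l)))" if "n \<in> N" for n
        using \<xi> that by simp
      from iffD2[OF has_sum_cong[OF this] has_sum_cmult_right[OF d]]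
      show "((\<lambda>n. p n l * inner (L i (\<psi> n l)) (E k (L j (\<psi> n l)))) has_sum \<xi> j * d i) N" .
    qed
    then show "F = I"
      using \<open>P \<noteq> 0\<close> by (simp add: vec_eq_iff F dP)
  qed

  \<comment> \<open>The implications close a cycle: saturation gives equal diagonals, these give
    proportionality, this gives \<open>F = I\<close>, and equal matrices saturate the bound.\<close>
  show ?thesis
    unfolding F_def[symmetric] I_def[symmetric]
    using matrix_bound_saturated_diagonal[of F I] matrix_bound_saturated_refl[of F]
      proportional equal by metis
qed

end
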